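(* Let $N=p_1^{n}p_2\cdots p_k$, where $p_1,\dots,p_k$ are distinct primes and $n,k$ are positive integers. If $A\subseteq\mathbb{Z}_N$ tiles $\mathbb{Z}_N$, then $A$ is spectral.
   Context: $\mathbb{Z}_N$ is the cyclic group $\mathbb{Z}/N\mathbb{Z}$ and $\zeta_N=e^{2\pi i/N}$. A set $A\subseteq\mathbb{Z}_N$ is called spectral if there is $B\subseteq\mathbb{Z}_N$ with $|A|=|B|$ and $\sum_{a\in A}\zeta_N^{a(b-b')}=0$ for all $b,b'\in B$ with $b\neq b'$. A set $A\subseteq\mathbb{Z}_N$ tiles $\mathbb{Z}_N$ (by translations) if there is $T\subseteq\mathbb{Z}_N$ such that every element of $\mathbb{Z}_N$ can be written uniquely as $a+t$ with $a\in A$, $t\in T$. *)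

theory Defs
  imports Complex_Main "HOL-Number_Theory.Residues"
begin

text \<open>
  The cyclic group of integers modulo \<open>N\<close> is the additive group of \<^const>\<open>residue_ring\<close>, whose carrier
  consists of the integers \<open>0, \<dots>, N - 1\<close>.
\<close>

abbreviation ZMod :: "nat \<Rightarrow> int ring"
  where "ZMod N \<equiv> residue_ring (int N)"

definition root_of_unity :: "nat \<Rightarrow> complex"
  where "root_of_unity N = exp (2 * of_real pi * \<i> / of_nat N)"

text \<open>
  The exponent below is computed with integer representatives instead of inside \<^term>\<open>ZMod N\<close>; as
  \<^term>\<open>root_of_unity N ^ N = 1\<close> for \<open>N > 0\<close>, the value only depends on the residue classes.
\<close>

definition spectral :: "nat \<Rightarrow> int set \<Rightarrow> bool"
  where "spectral N A \<longleftrightarrow> A \<subseteq> carrier (ZMod N) \<and>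
    (\<exists>B \<subseteq> carrier (ZMod N). card A = card B \<and>
      (\<forall>b\<in>B. \<forall>b'\<in>B. b \<noteq> b' \<longrightarrow> (\<Sum>a\<in>A. root_of_unity N powi (a * (b - b'))) = 0))"

definition tiles :: "nat \<Rightarrow> int set \<Rightarrow> bool"
  where "tiles N A \<longleftrightarrow> A \<subseteq> carrier (ZMod N) \<and>
    (\<exists>T \<subseteq> carrier (ZMod N). \<forall>x \<in> carrier (ZMod N).
      \<exists>!q. q \<in> A \<times> T \<and> x = fst q \<oplus>\<^bsub>ZMod N\<^esub> snd q)"

end

theory Submission
  imports Defs "HOL-Computational_Algebra.Polynomial"
begin

text \<open>
  Let \<open>A \<oplus> T = \<int>/N\<close> be a tiling with \<open>N = p^n Q\<close>, \<open>Q\<close> squarefree and prime to \<open>p\<close>. Each prime factor of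
  \<open>Q\<close> divides exactly one of \<open>card A\<close> and \<open>card T\<close>; let \<open>U\<close> and \<open>W\<close> be the products of those dividing \<open>card A\<close>
  and \<open>card T\<close>. A factor of a tiling may be multiplied by any number prime to its cardinality
  (Sands, Tijdeman). Applied to both factors, this shows that the set \<open>V\<close> of \<open>p\<close>-adic valuations of
  differences in \<open>A\<close> divisible by \<open>U\<close> is disjoint from the corresponding set \<open>V'\<close> for \<open>T\<close> and \<open>W\<close>. As
  \<open>card A \<le> p^(card V) U\<close> and \<open>card T \<le> p^(card V') W\<close> while \<open>card V + card V' \<le> n\<close>, equality holds throughout.
  The numbers \<open>\<Sum>v\<in>V. k v * N / p^(v+1) + l * N / U\<close> with \<open>0 \<le> k v < p\<close> and \<open>0 \<le> l < U\<close> then form a spectrum: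
  the sum of their characters at a nonzero difference of \<open>A\<close> factors into geometric sums, one of
  which vanishes.
\<close>

section \<open>Dilation of a tiling factor\<close>

text \<open>The inner binomial coefficients are divisible by \<open>q\<close>. The explicit
  remainder \<open>of_nat q * c\<close> makes sense in every commutative ring; the ring of interest
  is \<open>int poly\<close>.\<close>

lemma freshman_prime_power:
  fixes x y :: "'a::comm_ring_1"
  assumes "prime q"
  shows "\<exists>c. (x + y) ^ q = x ^ q + y ^ q + of_nat q * c"
proof -
  have q: "q > 0" using assms prime_gt_0_nat by blast
  have dvd: "q dvd (q choose k)" if "k \<in> {1..<q}" for k
    using that assms by (intro dvd_choose_prime) auto
  have "(x + y) ^ q = (\<Sum>k\<le>q. of_nat (q choose k) * x ^ k * y ^ (q - k))"
    by (rule binomial_ring)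
  also have "{..q} = insert 0 (insert q {1..<q})" using q by auto
  also have "(\<Sum>k\<in>insert 0 (insert q {1..<q}). of_nat (q choose k) * x ^ k * y ^ (q - k))
      = y ^ q + x ^ q + (\<Sum>k\<in>{1..<q}. of_nat (q choose k) * x ^ k * y ^ (q - k))"
    using q by (simp add: add.assoc)
  also have "(\<Sum>k\<in>{1..<q}. of_nat (q choose k) * x ^ k * y ^ (q - k))
      = (\<Sum>k\<in>{1..<q}. of_nat q * (of_nat ((q choose k) div q) * x ^ k * y ^ (q - k)))"
  proof (rule sum.cong[OF refl])
    fix k assume "k \<in> {1..<q}"
    then have "q choose k = q * ((q choose k) div q)" using dvd by simp
    then have "(of_nat (q choose k) :: 'a) = of_nat q * of_nat ((q choose k) div q)"
      by (metis of_nat_mult)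
    then show "of_nat (q choose k) * x ^ k * y ^ (q - k)
        = of_nat q * (of_nat ((q choose k) div q) * x ^ k * y ^ (q - k))"
      by (simp add: mult.assoc)
  qed
  also have "\<dots> = of_nat q * (\<Sum>k\<in>{1..<q}. of_nat ((q choose k) div q) * x ^ k * y ^ (q - k))"
    by (simp add: sum_distrib_left)
  finally show ?thesis by (metis add.commute)
qed

lemma freshman_prime_power_sum:
  fixes f :: "'b \<Rightarrow> 'a::comm_ring_1"
  assumes "prime q" "finite T"
  shows "\<exists>c. (\<Sum>t\<in>T. f t) ^ q = (\<Sum>t\<in>T. f t ^ q) + of_nat q * c"
  using assms(2)
proof (induction rule: finite_induct)
  case empty
  then show ?case using assms(1) prime_gt_0_nat by (intro exI[of _ 0]) (simp add: power_0_left)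
next
  case (insert t T)
  then obtain c where c: "(\<Sum>t\<in>T. f t) ^ q = (\<Sum>t\<in>T. f t ^ q) + of_nat q * c" by blast
  obtain d where d: "(f t + sum f T) ^ q = f t ^ q + sum f T ^ q + of_nat q * d"
    using freshman_prime_power[OF assms(1)] by blast
  show ?case using insert.hyps c d by (intro exI[of _ "c + d"]) (simp add: algebra_simps)
qed

text \<open>Polynomials act on integer functions with the variable acting as the translation by one.\<close>

definition shift_act :: "int poly \<Rightarrow> (int \<Rightarrow> int) \<Rightarrow> int \<Rightarrow> int"
  where "shift_act P h x = (\<Sum>i\<le>degree P. coeff P i * h (x - int i))"

lemma shift_act_bound:
  assumes "degree P \<le> m"
  shows "shift_act P h x = (\<Sum>i\<le>m. coeff P i * h (x - int i))"
  unfolding shift_act_def using assms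
  by (intro sum.mono_neutral_left) (auto simp: coeff_eq_0)

lemma shift_act_0 [simp]: "shift_act 0 h x = 0"
  by (simp add: shift_act_def)

lemma shift_act_add: "shift_act (P + Q) h x = shift_act P h x + shift_act Q h x"
proof -
  define m where "m = max (degree P) (degree Q)"
  have "degree (P + Q) \<le> m" "degree P \<le> m" "degree Q \<le> m"
    unfolding m_def by (auto intro: degree_add_le)
  then show ?thesis
    by (simp add: shift_act_bound[of _ m] sum.distrib distrib_right)
qed

lemma shift_act_smult: "shift_act (smult c P) h x = c * shift_act P h x"
  by (cases "c = 0") (simp_all add: shift_act_def sum_distrib_left mult.assoc)

lemma shift_act_pCons: "shift_act (pCons c P) h x = c * h x + shift_act P h (x - 1)"
proof -
  have "shift_act (pCons c P) h x
      = (\<Sum>i\<le>Suc (degree P). coeff (pCons c P) i * h (x - int i))"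
    by (rule shift_act_bound) (rule degree_pCons_le)
  also have "\<dots> = c * h x + (\<Sum>i\<le>degree P. coeff P i * h (x - int (Suc i)))"
    by (subst sum.atMost_Suc_shift) simp
  also have "\<dots> = c * h x + shift_act P h (x - 1)"
    by (simp add: shift_act_def algebra_simps)
  finally show ?thesis .
qed

text \<open>This makes \<open>shift_act\<close> a module action, so a power of a polynomial can be
  applied one factor at a time.\<close>

lemma shift_act_mult: "shift_act (P * Q) h x = shift_act P (shift_act Q h) x"
  by (induction P arbitrary: x) (simp_all add: shift_act_add shift_act_smult shift_act_pCons)

lemma shift_act_monom: "shift_act (monom 1 i) h x = h (x - int i)"
proof (induction i arbitrary: x)
  case 0
  then show ?case by (simp add: shift_act_def)
next
  case (Suc i)
  then show ?case by (simp add: monom_Suc shift_act_pCons algebra_simps)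
qed

lemma shift_act_sum_monom:
  "shift_act (\<Sum>t\<in>T. monom 1 (e t)) h x = (\<Sum>t\<in>T. h (x - int (e t)))"
  by (induction T rule: infinite_finite_induct)
    (simp_all add: shift_act_add shift_act_monom)

text \<open>Constant functions are eigenvectors of a mask polynomial, with its number of terms as
  eigenvalue.\<close>

lemma shift_act_power_const:
  "shift_act ((\<Sum>t\<in>T. monom 1 (e t)) ^ j) (\<lambda>_. 1) x = int (card T) ^ j"
proof (induction j arbitrary: x)
  case 0
  then show ?case by (simp add: shift_act_def)
next
  case (Suc j)
  show ?case
    using Suc by (simp add: shift_act_mult shift_act_sum_monom)
qed

text \<open>A tiling in terms of maps into the integers: a dilation only changes a map, while the
  index sets and their cardinalities stay fixed. Injectivity and the cardinality condition together
  give a bijection onto the residues modulo \<open>N\<close>.\<close>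

definition complementing :: "nat \<Rightarrow> ('a \<Rightarrow> int) \<Rightarrow> ('b \<Rightarrow> int) \<Rightarrow> 'a set \<Rightarrow> 'b set \<Rightarrow> bool"
  where "complementing N f g A T \<longleftrightarrow> N > 0 \<and> finite A \<and> finite T \<and> card A * card T = N \<and>
    inj_on (\<lambda>(a, t). (f a + g t) mod int N) (A \<times> T)"

lemma complementing_commute:
  assumes "complementing N f g A T"
  shows "complementing N g f T A"
proof -
  have "inj_on (\<lambda>(t, a). (g t + f a) mod int N) (T \<times> A)"
  proof (rule inj_onI, clarsimp)
    fix t a t' a'
    assume *: "t \<in> T" "a \<in> A" "t' \<in> T" "a' \<in> A"
      "(g t + f a) mod int N = (g t' + f a') mod int N"
    then have "(a, t) = (a', t')"
      using assms unfolding complementing_def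
      by (elim conjE inj_onD) (auto simp: add.commute)
    then show "t = t' \<and> a = a'" by simp
  qed
  then show ?thesis using assms by (simp add: complementing_def mult.commute)
qed

lemma complementing_cong:
  assumes "complementing N f g A T" "\<And>t. t \<in> T \<Longrightarrow> [g t = g' t] (mod int N)"
  shows "complementing N f g' A T"
proof -
  have "(f a + g t) mod int N = (f a + g' t) mod int N" if "t \<in> T" for a t
    using assms(2)[OF that] by (metis cong_add_lcancel cong_def)
  then have "inj_on (\<lambda>(a, t). (f a + g t) mod int N) (A \<times> T)
      = inj_on (\<lambda>(a, t). (f a + g' t) mod int N) (A \<times> T)"
    by (intro inj_on_cong) auto
  then show ?thesis using assms(1) by (simp add: complementing_def)
qed

lemma complementingD:
  assumes "complementing N f g A T" "a \<in> A" "a' \<in> A" "t \<in> T" "t' \<in> T"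
    and "int N dvd (f a + g t) - (f a' + g t')"
  shows "a = a'" "t = t'"
proof -
  have "(f a + g t) mod int N = (f a' + g t') mod int N"
    using assms(6) by (simp add: mod_eq_dvd_iff)
  then have "(a, t) = (a', t')"
    using assms(1-5) unfolding complementing_def by (elim conjE inj_onD) auto
  then show "a = a'" "t = t'" by auto
qed

text \<open>Modulo the prime \<open>q\<close>, the \<open>q\<close>-th power of the mask polynomial of \<open>T\<close> is the mask polynomial
  of the dilate of \<open>T\<close> by \<open>q\<close>. So every residue has a number of representations congruent to
  \<open>card T ^ (q - 1)\<close>, hence to 1, modulo \<open>q\<close>; in particular it has at least one.\<close>

lemma complementing_prime_dilate:
  assumes "complementing N f g A T" "prime q" "\<not> q dvd card T"
  shows "complementing N f (\<lambda>t. int q * g t) A T"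
proof -
  have N: "N > 0" and fin: "finite A" "finite T" and card: "card A * card T = N"
    and inj: "inj_on (\<lambda>(a, t). (f a + g t) mod int N) (A \<times> T)"
    using assms(1) by (auto simp: complementing_def)
  \<comment> \<open>Exponents of a polynomial must be natural numbers, hence the reduced
    representatives.\<close>
  define e where "e t = nat (g t mod int N)" for t
  have e: "[int (e t) = g t] (mod int N)" for t
    using N by (simp add: e_def cong_def)
  \<comment> \<open>An \<open>N\<close>-periodic function on the integers, so that translations act
    as in the cyclic group.\<close>
  define h where "h x = (\<Sum>a\<in>A. of_bool (int N dvd x - f a) :: int)" for x :: int
  define P :: "int poly" where "P = (\<Sum>t\<in>T. monom 1 (e t))"
  have count: "(\<Sum>t\<in>T. h (x - u t)) = int (card {z \<in> A \<times> T. int N dvd x - (f (fst z) + u (snd z))})"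
    for x and u :: "'b \<Rightarrow> int"
  proof -
    have "(\<Sum>t\<in>T. h (x - u t)) = (\<Sum>a\<in>A. \<Sum>t\<in>T. of_bool (int N dvd x - (f a + u t)))"
      unfolding h_def by (subst sum.swap) (simp add: algebra_simps)
    also have "\<dots> = (\<Sum>z\<in>A \<times> T. of_bool (int N dvd x - (f (fst z) + u (snd z))))"
      by (simp add: sum.cartesian_product case_prod_beta)
    also have "\<dots> = int (card {z \<in> A \<times> T. int N dvd x - (f (fst z) + u (snd z))})"
      using fin by (simp add: Int_def flip: sum.inter_filter)
    finally show ?thesis .
  qed
  have cong_e: "complementing N f (\<lambda>t. int (e t)) A T"
    by (rule complementing_cong[OF assms(1)]) (simp add: e cong_sym)
  have card_img: "card (A \<times> T) = card {0..<int N}"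
    using card by (simp add: card_cartesian_product)
  \<comment> \<open>In this language the tiling says that \<open>P\<close> sends \<open>h\<close> to
    the constant function 1.\<close>
  have one: "shift_act P h x = 1" for x
  proof -
    let ?F = "\<lambda>(a, t). (f a + int (e t)) mod int N"
    have injF: "inj_on ?F (A \<times> T)" using cong_e by (simp add: complementing_def)
    have "?F ` (A \<times> T) = {0..<int N}"
    proof (rule card_subset_eq)
      show "?F ` (A \<times> T) \<subseteq> {0..<int N}" using N by auto
      show "card (?F ` (A \<times> T)) = card {0..<int N}"
        using card_image[OF injF] card_img by simp
    qed simp
    moreover have "x mod int N \<in> {0..<int N}" using N by simp
    ultimately obtain z where z: "z \<in> A \<times> T" "?F z = x mod int N"
      by (metis (no_types, lifting) imageE)
    have "{z \<in> A \<times> T. int N dvd x - (f (fst z) + int (e (snd z)))} = {z}"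
    proof -
      have iff: "int N dvd x - (f (fst y) + int (e (snd y))) \<longleftrightarrow> ?F y = x mod int N" for y
        by (auto simp: case_prod_beta mod_eq_dvd_iff dvd_diff_commute)
      show ?thesis
        unfolding iff
      proof (intro equalityI subsetI)
        fix y assume "y \<in> {z \<in> A \<times> T. ?F z = x mod int N}"
        then have "?F y = ?F z" "y \<in> A \<times> T" using z(2) by simp_all
        then show "y \<in> {z}" using inj_onD[OF injF _ _ z(1)] by simp
      qed (use z in simp)
    qed
    then show ?thesis
      unfolding P_def shift_act_sum_monom count by simp
  qed
  obtain C where C: "P ^ q = (\<Sum>t\<in>T. monom 1 (e t) ^ q) + of_nat q * C"
    using freshman_prime_power_sum[OF assms(2) fin(2)] unfolding P_def by blast
  have pos: "card {z \<in> A \<times> T. int N dvd x - (f (fst z) + int (e (snd z) * q))} > 0" for x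
  proof -
    let ?c = "card {z \<in> A \<times> T. int N dvd x - (f (fst z) + int (e (snd z) * q))}"
    \<comment> \<open>One factor \<open>P\<close> turns \<open>h\<close> into 1; each of the
      remaining \<open>q - 1\<close> factors contributes \<open>card T\<close>.\<close>
    have "P ^ q = P ^ (q - 1) * P"
      using power_minus_mult[OF prime_gt_0_nat[OF assms(2)], of P] by simp
    then have "shift_act (P ^ q) h x = shift_act (P ^ (q - 1)) (shift_act P h) x"
      by (simp add: shift_act_mult)
    also have "shift_act P h = (\<lambda>_. 1)" using one by blast
    also have "shift_act (P ^ (q - 1)) (\<lambda>_. 1) x = int (card T) ^ (q - 1)"
      unfolding P_def by (rule shift_act_power_const)
    finally have 1: "shift_act (P ^ q) h x = int (card T ^ (q - 1))" by simp
    \<comment> \<open>The second evaluation: up to a multiple of \<open>q\<close>, it counts the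
      representations of \<open>x\<close> in the dilated system.\<close>
    have "shift_act (P ^ q) h x = (\<Sum>t\<in>T. h (x - int (e t * q))) + int q * shift_act C h x"
      unfolding C
      by (simp add: shift_act_add monom_power shift_act_sum_monom of_nat_poly shift_act_smult)
    then have "int (card T ^ (q - 1)) = int ?c + int q * shift_act C h x"
      unfolding 1 by (simp only: count[of x "\<lambda>t. int (e t * q)"])
    moreover have "\<not> int q dvd int (card T ^ (q - 1))"
      using assms(2,3) by (metis int_dvd_int_iff prime_dvd_power)
    ultimately have "?c \<noteq> 0" by (metis dvd_triv_left add_0 of_nat_0)
    then show ?thesis by simp
  qed
  \<comment> \<open>Every residue is attained, and a surjection between finite sets of equal size is
    injective.\<close>
  let ?G = "\<lambda>(a, t). (f a + int (e t * q)) mod int N"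
  have "?G ` (A \<times> T) = {0..<int N}"
  proof
    show "?G ` (A \<times> T) \<subseteq> {0..<int N}" using N by auto
    show "{0..<int N} \<subseteq> ?G ` (A \<times> T)"
    proof
      fix x assume x: "x \<in> {0..<int N}"
      obtain z where z: "z \<in> A \<times> T" "int N dvd x - (f (fst z) + int (e (snd z) * q))"
        using pos[of x] by (metis (no_types, lifting) Collect_empty_eq card.empty less_irrefl)
      then have "x mod int N = ?G z" by (simp add: case_prod_beta mod_eq_dvd_iff)
      then have "x = ?G z" using x by simp
      then show "x \<in> ?G ` (A \<times> T)" using z(1) by blast
    qed
  qed
  then have "inj_on ?G (A \<times> T)"
    using card_img fin by (intro eq_card_imp_inj_on) auto
  then have "complementing N f (\<lambda>t. int (e t * q)) A T"
    using N fin card by (simp add: complementing_def)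
  moreover have "[int (e t * q) = int q * g t] (mod int N)" for t
    using cong_scalar_left[OF e[of t], of "int q"] by (simp add: mult.commute)
  ultimately show ?thesis by (rule complementing_cong)
qed

text \<open>Prime factors of \<open>r\<close> are applied one after another, each to a map that is
  already dilated; \<open>card T\<close> never changes.\<close>

lemma complementing_dilate_nat:
  assumes "complementing N f g A T" "r > 0" "coprime r (card T)"
  shows "complementing N f (\<lambda>t. int r * g t) A T"
  using assms(2,3)
proof (induction r rule: less_induct)
  case (less r)
  show ?case
  proof (cases "r = 1")
    case True
    then show ?thesis using assms(1) by simp
  next
    case False
    then obtain q where q: "prime q" "q dvd r" using prime_factor_nat by blast
    then obtain s where s: "r = q * s" by blast
    have "s > 0" "s < r" using s less.prems(1) prime_gt_1_nat[OF q(1)] by auto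
    moreover have "coprime s (card T)" "coprime q (card T)" using less.prems(2) s by auto
    ultimately have "complementing N f (\<lambda>t. int s * g t) A T"
      using less.IH by blast
    moreover have "\<not> q dvd card T"
      using \<open>coprime q (card T)\<close> q(1) by (metis coprime_absorb_left not_prime_unit)
    ultimately have "complementing N f (\<lambda>t. int q * (int s * g t)) A T"
      using complementing_prime_dilate q(1) by blast
    then show ?thesis by (simp add: s mult.assoc)
  qed
qed

lemma complementing_dilate:
  assumes "complementing N f g A T" "coprime r (int (card T))"
  shows "complementing N f (\<lambda>t. r * g t) A T"
proof -
  have N: "N > 0" "card T dvd N" using assms(1) by (auto simp: complementing_def)
  \<comment> \<open>Adding \<open>N\<close> keeps \<open>s\<close> positive even if \<open>N\<close>
    divides \<open>r\<close>, which can happen when \<open>card T\<close> is 1.\<close>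
  define s where "s = nat (r mod int N + int N)"
  have s: "int s = r mod int N + int N" "s > 0"
    using N(1) by (simp_all add: s_def pos_mod_sign add_nonneg_pos)
  then have rs: "[int s = r] (mod int N)" by (simp add: cong_def)
  then have "[int s = r] (mod int (card T))"
    using N(2) by (metis cong_dvd_modulus int_dvd_int_iff)
  then have "coprime s (card T)"
    using assms(2) by (metis cong_imp_coprime cong_sym coprime_int_iff)
  then have "complementing N f (\<lambda>t. int s * g t) A T"
    using complementing_dilate_nat[OF assms(1) s(2)] by blast
  then show ?thesis
    by (rule complementing_cong) (rule cong_scalar_right[OF rs])
qed

section \<open>Valuations of differences in a tiling\<close>

text \<open>If the valuations agreed, suitable dilations of the factors would identify the two differences
  modulo \<open>N\<close>.\<close>

lemma complementing_multiplicity_neq: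
  fixes p n U W N :: nat
  assumes comp: "complementing N f g A T" and N: "N = p ^ n * U * W"
    and p: "prime p" and copU: "coprime p U" and copW: "coprime p W" and copUW: "coprime U W"
    and copWA: "coprime W (card A)" and copUT: "coprime U (card T)"
    and a: "a \<in> A" "a' \<in> A" "a \<noteq> a'" "int U dvd f a - f a'"
    and t: "t \<in> T" "t' \<in> T" "t \<noteq> t'" "int W dvd g t - g t'"
  shows "multiplicity (int p) (f a - f a') \<noteq> multiplicity (int p) (g t - g t')"
proof
  assume eq: "multiplicity (int p) (f a - f a') = multiplicity (int p) (g t - g t')"
  define v where "v = multiplicity (int p) (f a - f a')"
  have "f a \<noteq> f a'" using complementingD(1)[OF comp a(1,2) t(1,1)] a(3) by auto
  moreover have "g t \<noteq> g t'" using complementingD(2)[OF comp a(1,1) t(1,2)] t(3) by auto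
  moreover have unit: "\<not> is_unit (int p)" using p by (metis not_prime_unit prime_nat_int_transfer)
  ultimately obtain u w where u: "f a - f a' = int p ^ v * u" "\<not> int p dvd u"
    and w: "g t - g t' = int p ^ v * w" "\<not> int p dvd w"
    using multiplicity_decompose'[of "f a - f a'" "int p"] multiplicity_decompose'[of "g t - g t'" "int p"]
    unfolding eq[symmetric] v_def[symmetric] by (metis right_minus_eq)
  have primep: "prime (int p)" using p by simp
  have cu: "coprime (int p) u" and cw: "coprime (int p) w"
    using u(2) w(2) primep by (simp_all add: prime_imp_coprime)
  \<comment> \<open>The exponent exceeds \<open>n\<close> so that working modulo
    \<open>p ^ m\<close> still detects divisibility by \<open>p\<close> when \<open>n\<close> is
    0.\<close>
  define m where "m = Suc n"
  have "coprime (int U * w) (int p ^ m)"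
    using cw copU by (simp add: coprime_commute coprime_mult_left_iff)
  then obtain c where c: "[int U * w * c = 1] (mod int p ^ m)"
    using cong_solve_coprime_int by blast
  have "coprime (int p ^ m) (int W)" using copW by simp
  then obtain s where s: "[s = c * (int W * u)] (mod int p ^ m)" "[s = 1] (mod int W)"
    using binary_chinese_remainder_int by blast
  have "[int U * w * s = int U * w * c * (int W * u)] (mod int p ^ m)"
    using cong_scalar_left[OF s(1), of "int U * w"] by (simp add: mult.assoc)
  also have "[int U * w * c * (int W * u) = 1 * (int W * u)] (mod int p ^ m)"
    by (rule cong_scalar_right[OF c])
  finally have key: "[int U * w * s = int W * u] (mod int p ^ m)" by simp
  have "coprime (int W * u) (int p ^ m)"
    using cu copW by (simp add: coprime_commute coprime_mult_left_iff)
  then have "coprime (int U * w * s) (int p ^ m)"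
    using key by (metis cong_imp_coprime cong_sym)
  then have sp: "coprime s (int p)" by (simp add: m_def)
  have sW: "coprime s (int W)" using s(2) by (metis cong_imp_coprime cong_sym coprime_1_left)
  have "card T dvd N" using comp by (auto simp: complementing_def)
  \<comment> \<open>Being prime to \<open>U\<close>, \<open>card T\<close> has prime factors only
    from \<open>p\<close> and \<open>W\<close>, and \<open>s\<close> is prime to both.\<close>
  then have "card T dvd U * (p ^ n * W)" by (simp add: N mult_ac)
  then have "card T dvd p ^ n * W"
    using copUT by (simp add: coprime_dvd_mult_right_iff coprime_commute)
  moreover have "coprime s (int (p ^ n * W))" using sp sW by simp
  ultimately have "coprime s (int (card T))"
    by (metis coprime_divisors dvd_refl int_dvd_int_iff)
  then have "coprime (s * int U) (int (card T))" using copUT by simp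
  then have "complementing N f (\<lambda>t. s * int U * g t) A T"
    by (rule complementing_dilate[OF comp])
  then have "complementing N (\<lambda>t. s * int U * g t) (\<lambda>a. int W * f a) T A"
    by (rule complementing_dilate[OF complementing_commute]) (use copWA in simp)
  then have comp': "complementing N (\<lambda>a. int W * f a) (\<lambda>t. s * int U * g t) A T"
    by (rule complementing_commute)
  \<comment> \<open>The dilations by \<open>W\<close> and \<open>s * U\<close> make both terms
    divisible by \<open>U\<close> and by \<open>W\<close>; the choice of \<open>s\<close> makes
    their difference divisible by \<open>p ^ n\<close>.\<close>
  define D where "D = int W * (f a - f a') - s * int U * (g t - g t')"
  have "D = int p ^ v * (int W * u - int U * w * s)"
    unfolding D_def u(1) w(1) by (simp add: algebra_simps)
  moreover have "int p ^ m dvd int W * u - int U * w * s"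
    using cong_sym[OF key] by (simp add: cong_iff_dvd_diff)
  ultimately have "int p ^ m dvd D" by simp
  then have Dp: "int p ^ n dvd D" by (metis m_def le_imp_power_dvd dvd_trans lessI less_imp_le)
  have DU: "int U dvd D" using a(4) unfolding D_def by simp
  have DW: "int W dvd D" using t(4) unfolding D_def by simp
  have "int p ^ n * int U * int W dvd D"
    using Dp DU DW copU copW copUW by (intro divides_mult) simp_all
  \<comment> \<open>Exchanging \<open>t\<close> and \<open>t'\<close> turns this into two
    representations of one residue.\<close>
  then have "int N dvd (int W * f a + s * int U * g t') - (int W * f a' + s * int U * g t)"
    by (simp add: N D_def algebra_simps)
  then show False using complementingD(1)[OF comp' a(1,2) t(2,1)] a(3) by simp
qed

text \<open>Otherwise the difference is divisible by \<open>p ^ n * U\<close>, and the admissible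
  dilation by \<open>W\<close> makes the two elements collide modulo \<open>N\<close>.\<close>

lemma complementing_multiplicity_less:
  fixes p n U W N :: nat
  assumes comp: "complementing N f g A T" and N: "N = p ^ n * U * W"
    and p: "prime p" and copU: "coprime p U" and copWA: "coprime W (card A)"
    and a: "a \<in> A" "a' \<in> A" "a \<noteq> a'" "int U dvd f a - f a'"
  shows "multiplicity (int p) (f a - f a') < n"
proof -
  have "\<not> int p ^ n dvd f a - f a'"
  proof
    assume "int p ^ n dvd f a - f a'"
    then have "int p ^ n * int U dvd f a - f a'"
      using a(4) copU by (intro divides_mult) simp_all
    then have "int W * (int p ^ n * int U) dvd int W * (f a - f a')"
      by (rule mult_dvd_mono[OF dvd_refl])
    then have dvd: "int N dvd int W * f a - int W * f a'"
      by (simp add: N algebra_simps)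
    have "complementing N (\<lambda>a. int W * f a) g A T"
      using complementing_dilate[OF complementing_commute[OF comp]] copWA
      by (intro complementing_commute[of N g]) simp
    moreover obtain t where "t \<in> T"
      using comp by (fastforce simp: complementing_def)
    ultimately show False
      using complementingD(1)[of N "\<lambda>a. int W * f a" g A T a a' t t] a dvd by simp
  qed
  moreover from this have "f a - f a' \<noteq> 0" by auto
  moreover have "\<not> is_unit (int p)" using p by (metis not_prime_unit prime_nat_int_transfer)
  ultimately show ?thesis by (intro multiplicity_lessI)
qed

text \<open>The residue modulo \<open>U\<close> and the base-\<open>p\<close> digits at the places in \<open>V\<close> determine the element.\<close>

lemma card_le_if_multiplicities:
  fixes p U :: nat and f :: "'a \<Rightarrow> int"
  assumes p: "prime p" and U: "U > 0" and V: "finite V"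
    and diff: "\<And>a a'. a \<in> A \<Longrightarrow> a' \<in> A \<Longrightarrow> a \<noteq> a' \<Longrightarrow> int U dvd f a - f a' \<Longrightarrow>
      f a \<noteq> f a' \<and> multiplicity (int p) (f a - f a') \<in> V"
  shows "card A \<le> p ^ card V * U"
proof -
  let ?B = "(V \<rightarrow>\<^sub>E {0..<int p}) \<times> {0..<int U}"
  define F where "F a = (restrict (\<lambda>v. (f a div int p ^ v) mod int p) V, f a mod int U)" for a
  have ppos: "int p > 0" using p prime_gt_0_nat by simp
  have "inj_on F A"
  proof (rule inj_onI, rule ccontr)
    fix a a' assume a: "a \<in> A" "a' \<in> A" and eq: "F a = F a'" and neq: "a \<noteq> a'"
    have "int U dvd f a - f a'" using eq by (simp add: F_def mod_eq_dvd_iff)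
    then have *: "f a \<noteq> f a'" "multiplicity (int p) (f a - f a') \<in> V" using diff a neq by auto
    define v where "v = multiplicity (int p) (f a - f a')"
    have "\<not> is_unit (int p)" using p by (metis not_prime_unit prime_nat_int_transfer)
    then obtain u where u: "f a - f a' = int p ^ v * u" "\<not> int p dvd u"
      using multiplicity_decompose'[of "f a - f a'" "int p"] * v_def by auto
    \<comment> \<open>Adding \<open>u * p ^ v\<close> shifts the quotient by \<open>p ^ v\<close> by
      \<open>u\<close>, a nonzero residue modulo \<open>p\<close>, so the digit at place
      \<open>v\<close> changes.\<close>
    have "f a = f a' + u * int p ^ v" using u(1) by (simp add: algebra_simps)
    then have "f a div int p ^ v = u + f a' div int p ^ v"
      using ppos by (simp add: div_mult_self1)
    moreover have "(f a div int p ^ v) mod int p = (f a' div int p ^ v) mod int p"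
      using fun_cong[OF arg_cong[OF eq, of fst], of v] *(2) by (simp add: F_def flip: v_def)
    ultimately show False using u(2) by (simp add: mod_eq_dvd_iff)
  qed
  moreover have "F ` A \<subseteq> ?B" using ppos U by (auto simp: F_def)
  moreover have "finite ?B" using V by (simp add: finite_PiE)
  ultimately have "card A \<le> card ?B" by (rule card_inj_on_le)
  also have "card ?B = p ^ card V * U" using V by (simp add: card_cartesian_product card_PiE)
  finally show ?thesis .
qed

lemma complementing_structure:
  fixes p n U W N :: nat
  assumes comp: "complementing N f g A T" and N: "N = p ^ n * U * W"
    and p: "prime p" and copU: "coprime p U" and copW: "coprime p W" and copUW: "coprime U W"
    and copWA: "coprime W (card A)" and copUT: "coprime U (card T)"
  obtains V where "V \<subseteq> {..<n}" "card A = p ^ card V * U"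
    "\<And>a a'. a \<in> A \<Longrightarrow> a' \<in> A \<Longrightarrow> a \<noteq> a' \<Longrightarrow> int U dvd f a - f a' \<Longrightarrow>
      multiplicity (int p) (f a - f a') \<in> V"
proof -
  define V where "V = {multiplicity (int p) (f a - f a') | a a'.
    a \<in> A \<and> a' \<in> A \<and> a \<noteq> a' \<and> int U dvd f a - f a'}"
  define V' where "V' = {multiplicity (int p) (g t - g t') | t t'.
    t \<in> T \<and> t' \<in> T \<and> t \<noteq> t' \<and> int W dvd g t - g t'}"
  have comp': "complementing N g f T A" by (rule complementing_commute[OF comp])
  have N': "N = p ^ n * W * U" using N by (simp add: mult_ac)
  have pos: "N > 0" "card A * card T = N" using comp by (auto simp: complementing_def)
  then have UW: "U > 0" "W > 0" "p > 0" using N p prime_gt_0_nat by auto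
  obtain a0 t0 where mem: "a0 \<in> A" "t0 \<in> T"
    using pos by (metis card_eq_0_iff ex_in_conv mult_eq_0_iff less_irrefl)
  have V: "V \<subseteq> {..<n}"
    using complementing_multiplicity_less[OF comp N p copU copWA] unfolding V_def by blast
  have V': "V' \<subseteq> {..<n}"
    using complementing_multiplicity_less[OF comp' N' p copW copUT] unfolding V'_def by blast
  have "V \<inter> V' = {}"
    using complementing_multiplicity_neq[OF comp N p copU copW copUW copWA copUT]
    unfolding V_def V'_def by blast
  moreover have fin: "finite V" "finite V'" using V V' finite_subset by blast+
  ultimately have "card V + card V' = card (V \<union> V')" by (simp add: card_Un_disjoint)
  also have "\<dots> \<le> n" using card_mono[of "{..<n}" "V \<union> V'"] V V' by simp
  finally have le: "card V + card V' \<le> n" .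
  have inj: "f a \<noteq> f a'" if "a \<in> A" "a' \<in> A" "a \<noteq> a'" for a a'
    using complementingD(1)[OF comp that(1,2) mem(2) mem(2)] that(3) by auto
  have inj': "g t \<noteq> g t'" if "t \<in> T" "t' \<in> T" "t \<noteq> t'" for t t'
    using complementingD(2)[OF comp mem(1) mem(1) that(1,2)] that(3) by auto
  have A: "card A \<le> p ^ card V * U"
    using inj by (intro card_le_if_multiplicities[OF p UW(1) fin(1)]) (auto simp: V_def)
  have T: "card T \<le> p ^ card V' * W"
    using inj' by (intro card_le_if_multiplicities[OF p UW(2) fin(2)]) (auto simp: V'_def)
  have "card A = p ^ card V * U"
  proof (rule ccontr)
    \<comment> \<open>A strict inequality here would survive in the product of the two bounds, which
      is at most \<open>N\<close>.\<close>
    assume "card A \<noteq> p ^ card V * U"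
    then have less: "card A < p ^ card V * U" using A by simp
    have "N = card A * card T" using pos by simp
    also have "\<dots> \<le> card A * (p ^ card V' * W)" using T by simp
    also have "\<dots> < p ^ card V * U * (p ^ card V' * W)" using less UW by simp
    also have "\<dots> = p ^ (card V + card V') * (U * W)" by (simp add: power_add mult_ac)
    also have "\<dots> \<le> p ^ n * (U * W)"
      using le UW by (intro mult_right_mono power_increasing) auto
    also have "\<dots> = N" using N by (simp add: mult.assoc)
    finally show False by simp
  qed
  with V that show ?thesis unfolding V_def by blast
qed

section \<open>Construction of a spectrum\<close>

lemma root_of_unity_powi: "root_of_unity N powi x = cis (2 * pi * of_int x / of_nat N)"
proof -
  have "root_of_unity N = cis (2 * pi / of_nat N)"
    by (simp add: root_of_unity_def cis_conv_exp mult_ac)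
  then show ?thesis by (simp add: cis_power_int mult_ac)
qed

lemma root_of_unity_powi_eq_1_iff:
  assumes "N > 0"
  shows "root_of_unity N powi x = 1 \<longleftrightarrow> int N dvd x"
proof
  assume "root_of_unity N powi x = 1"
  then have "cos (2 * pi * of_int x / of_nat N) = 1"
    by (simp add: root_of_unity_powi complex_eq_iff)
  then obtain m :: int where "2 * pi * of_int x / of_nat N = of_int m * 2 * pi"
    using cos_one_2pi_int by blast
  then have "real_of_int x = of_int (int N * m)" using assms by (simp add: field_simps)
  then have "x = int N * m" by (simp only: of_int_eq_iff)
  then show "int N dvd x" by simp
next
  assume "int N dvd x"
  then obtain m where "x = int N * m" by blast
  then have "2 * pi * of_int x / of_nat N = 2 * pi * real_of_int m"
    using assms by simp
  then have "root_of_unity N powi x = cis (2 * pi * real_of_int m)"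
    by (simp only: root_of_unity_powi)
  then show "root_of_unity N powi x = 1"
    by (simp only: cis_multiple_2pi Ints_of_int)
qed

lemma root_of_unity_nonzero [simp]: "root_of_unity N \<noteq> 0"
  by (simp add: root_of_unity_def)

lemma root_of_unity_powi_cong:
  assumes "N > 0" "[x = y] (mod int N)"
  shows "root_of_unity N powi x = root_of_unity N powi y"
proof -
  have "root_of_unity N powi (x - y) = 1"
    using assms by (simp add: root_of_unity_powi_eq_1_iff cong_iff_dvd_diff)
  then show ?thesis by (simp add: power_int_diff)
qed

text \<open>The matrix of the characters \<open>b i\<close> on \<open>A\<close> is square, so it suffices that its columns are
  orthogonal: then the squared moduli of the inner products of a row with all rows
  add up to \<open>(card A)^2\<close>, which the row itself contributes already.\<close>

lemma spectral_if_dual_orthogonal: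
  fixes b :: "'i \<Rightarrow> int"
  assumes N: "N > 0" and A: "A \<subseteq> carrier (ZMod N)" and I: "finite I" "card I = card A"
    and orth: "\<And>a a'. a \<in> A \<Longrightarrow> a' \<in> A \<Longrightarrow> a \<noteq> a' \<Longrightarrow>
      (\<Sum>i\<in>I. root_of_unity N powi ((a - a') * b i)) = 0"
  shows "spectral N A"
proof -
  define E where "E x = root_of_unity N powi x" for x
  have E_add: "E (x + y) = E x * E y" for x y by (simp add: E_def power_int_add)
  have E_cnj: "cnj (E x) = E (- x)" for x by (simp add: E_def root_of_unity_powi cis_cnj)
  have E_0: "E 0 = 1" by (simp add: E_def)
  have finA: "finite A" using A by (rule finite_subset) (simp add: residue_ring_def)
  define S where "S i j = (\<Sum>a\<in>A. E (a * (b i - b j)))" for i j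
  have S_refl: "S i i = of_nat (card A)" for i by (simp add: S_def E_0)
  have S_0: "S i j = 0" if ij: "i \<in> I" "j \<in> I" "i \<noteq> j" for i j
  proof -
    \<comment> \<open>Once the sum over \<open>j\<close> is innermost, \<open>orth\<close> leaves
      only the diagonal terms \<open>a = a'\<close>.\<close>
    have "(\<Sum>j\<in>I. S i j * cnj (S i j))
        = (\<Sum>j\<in>I. \<Sum>a\<in>A. \<Sum>a'\<in>A. E ((a - a') * b i) * E ((a' - a) * b j))"
      unfolding S_def cnj_sum E_cnj sum_product
      by (intro sum.cong refl) (simp add: algebra_simps flip: E_add)
    also have "\<dots> = (\<Sum>a\<in>A. \<Sum>a'\<in>A. \<Sum>j\<in>I. E ((a - a') * b i) * E ((a' - a) * b j))"
      by (subst sum.swap, rule sum.cong[OF refl], subst sum.swap, rule refl)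
    also have "\<dots> = (\<Sum>a\<in>A. \<Sum>a'\<in>A. if a = a' then of_nat (card A) else 0)"
    proof (intro sum.cong refl)
      fix a a' assume "a \<in> A" "a' \<in> A"
      then show "(\<Sum>j\<in>I. E ((a - a') * b i) * E ((a' - a) * b j))
          = (if a = a' then of_nat (card A) else 0)"
        using orth[of a' a] I by (auto simp: E_0 E_def simp flip: sum_distrib_left)
    qed
    also have "\<dots> = of_nat (card A * card A)" using finA by simp
    finally have "(\<Sum>j\<in>I. of_real ((cmod (S i j))\<^sup>2)) = (of_nat (card A * card A) :: complex)"
      by (simp only: complex_norm_square)
    then have "complex_of_real (\<Sum>j\<in>I. (cmod (S i j))\<^sup>2) = of_real (real (card A) ^ 2)"
      by (simp add: power2_eq_square)
    then have "(\<Sum>j\<in>I. (cmod (S i j))\<^sup>2) = real (card A) ^ 2"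
      by (simp only: of_real_eq_iff)
    moreover have "(\<Sum>j\<in>I. (cmod (S i j))\<^sup>2)
        = (cmod (S i i))\<^sup>2 + (\<Sum>j\<in>I - {i}. (cmod (S i j))\<^sup>2)"
      using I(1) ij(1) by (rule sum.remove)
    ultimately have "(\<Sum>j\<in>I - {i}. (cmod (S i j))\<^sup>2) = 0" by (simp add: S_refl)
    then have "\<forall>j\<in>I - {i}. (cmod (S i j))\<^sup>2 = 0"
      using I(1) by (subst (asm) sum_nonneg_eq_0_iff) auto
    then show ?thesis using ij by auto
  qed
  \<comment> \<open>A spectrum must consist of reduced residues. Reduction keeps the frequencies
    distinct, since a collision would give \<open>S i j\<close> the nonzero value
    \<open>card A\<close>.\<close>
  define B where "B = (\<lambda>i. b i mod int N) ` I"
  have E_mod: "E (a * (b i mod int N - b j mod int N)) = E (a * (b i - b j))" for a i j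
    unfolding E_def
    by (intro root_of_unity_powi_cong[OF N] cong_scalar_left cong_diff) (simp_all add: cong_def)
  have inj: "inj_on (\<lambda>i. b i mod int N) I"
  proof (rule inj_onI, rule ccontr)
    fix i j assume ij: "i \<in> I" "j \<in> I" "b i mod int N = b j mod int N" "i \<noteq> j"
    then have "S i j = of_nat (card A)"
      using E_mod[of _ i j] by (simp add: S_def E_0)
    moreover have "card A \<noteq> 0" using I ij(1) by (metis card_0_eq empty_iff)
    ultimately show False using S_0[OF ij(1,2,4)] by simp
  qed
  have "card A = card B" using card_image[OF inj] I(2) by (simp add: B_def)
  moreover have "B \<subseteq> carrier (ZMod N)" using N by (auto simp: B_def residue_ring_def)
  moreover have "(\<Sum>a\<in>A. root_of_unity N powi (a * (c - c'))) = 0"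
    if c: "c \<in> B" "c' \<in> B" "c \<noteq> c'" for c c'
  proof -
    obtain i j where ij: "i \<in> I" "c = b i mod int N" "j \<in> I" "c' = b j mod int N"
      using c unfolding B_def by blast
    then have "i \<noteq> j" using c(3) by blast
    then show ?thesis using S_0[OF ij(1,3)] ij E_mod by (simp add: S_def flip: E_def)
  qed
  ultimately show ?thesis using A unfolding spectral_def by blast
qed

section \<open>The spectrum and its geometric sums\<close>

lemma sum_powers_root_of_unity_eq_0:
  assumes "N > 0" "int N dvd x * int m" "\<not> int N dvd x"
  shows "(\<Sum>k<m. (root_of_unity N powi x) ^ k) = 0"
proof -
  have "(root_of_unity N powi x) ^ m = root_of_unity N powi (x * int m)"
    by (simp add: power_int_mult)
  then show ?thesis
    using assms by (simp add: root_of_unity_powi_eq_1_iff geometric_sum)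
qed

lemma spectral_if_multiplicities:
  fixes p n U W N :: nat
  assumes N: "N = p ^ n * U * W" "N > 0" and p: "prime p"
    and A: "A \<subseteq> carrier (ZMod N)" and V: "V \<subseteq> {..<n}" and card: "card A = p ^ card V * U"
    and diff: "\<And>a a'. a \<in> A \<Longrightarrow> a' \<in> A \<Longrightarrow> a \<noteq> a' \<Longrightarrow> int U dvd a - a' \<Longrightarrow>
      multiplicity (int p) (a - a') \<in> V"
  shows "spectral N A"
proof -
  let ?I = "(V \<rightarrow>\<^sub>E {..<p}) \<times> {..<U}"
  \<comment> \<open>These are \<open>N / p ^ (v + 1)\<close> and, below, \<open>N / U\<close>,
    written without division; the subtraction is not truncated for \<open>v\<close> in
    \<open>V\<close>.\<close>
  define c where "c v = int (p ^ (n - Suc v) * U * W)" for v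
  define d where "d = int (p ^ n * W)"
  define b where "b z = (\<Sum>v\<in>V. c v * int (fst z v)) + d * int (snd z)" for z :: "(nat \<Rightarrow> nat) \<times> nat"
  have V': "finite V" using V finite_subset by blast
  have cN: "c v * int p ^ Suc v = int N" if "v \<in> V" for v
  proof -
    have "n = (n - Suc v) + Suc v" using V that by auto
    then have "int p ^ n = int p ^ (n - Suc v) * int p ^ Suc v" by (metis power_add)
    then show ?thesis by (simp add: c_def N(1) mult_ac)
  qed
  have dN: "d * int U = int N" by (simp add: d_def N(1) mult_ac)
  \<comment> \<open>The digits \<open>fst z v\<close> and the coordinate \<open>snd z\<close> vary
    independently, so the character sum is a product of one-variable sums.\<close>
  have factor: "(\<Sum>z\<in>?I. root_of_unity N powi (x * b z))
      = (\<Prod>v\<in>V. \<Sum>k<p. (root_of_unity N powi (x * c v)) ^ k)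
        * (\<Sum>l<U. (root_of_unity N powi (x * d)) ^ l)" for x
  proof -
    have powi_sum: "root_of_unity N powi (sum h V) = (\<Prod>v\<in>V. root_of_unity N powi (h v))"
      for h :: "nat \<Rightarrow> int"
      using V' by (induction V rule: finite_induct) (simp_all add: power_int_add)
    have "root_of_unity N powi (x * b z) = (\<Prod>v\<in>V. (root_of_unity N powi (x * c v)) ^ fst z v)
        * (root_of_unity N powi (x * d)) ^ snd z" for z
    proof -
      have "x * b z = (\<Sum>v\<in>V. x * c v * int (fst z v)) + x * d * int (snd z)"
        by (simp add: b_def distrib_left sum_distrib_left mult.assoc)
      then show ?thesis by (simp only: power_int_add powi_sum root_of_unity_nonzero
          power_int_mult power_int_of_nat simp_thms)
    qed
    then have "(\<Sum>z\<in>?I. root_of_unity N powi (x * b z))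
        = (\<Sum>k\<in>V \<rightarrow>\<^sub>E {..<p}. \<Prod>v\<in>V. (root_of_unity N powi (x * c v)) ^ k v)
          * (\<Sum>l<U. (root_of_unity N powi (x * d)) ^ l)"
      by (simp add: sum_product sum.cartesian_product case_prod_beta)
    then show ?thesis using V' by (simp add: prod_sum_PiE)
  qed
  have orth: "(\<Sum>z\<in>?I. root_of_unity N powi ((a - a') * b z)) = 0"
    if a: "a \<in> A" "a' \<in> A" "a \<noteq> a'" for a a'
  proof (cases "int U dvd a - a'")
    case False
    \<comment> \<open>Here the sum over the last coordinate vanishes: its ratio is a
      \<open>U\<close>-th root of unity different from 1.\<close>
    have "d \<noteq> 0" using dN N(2) by auto
    have "\<not> int N dvd (a - a') * d"
      using False \<open>d \<noteq> 0\<close> by (simp flip: dN add: mult.commute[of _ d])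
    moreover have "int N dvd (a - a') * d * int U" by (simp add: mult.assoc dN)
    ultimately have "(\<Sum>l<U. (root_of_unity N powi ((a - a') * d)) ^ l) = 0"
      using sum_powers_root_of_unity_eq_0 N(2) by blast
    then show ?thesis by (simp add: factor)
  next
    case True
    \<comment> \<open>Here the factor at this place vanishes: \<open>p ^ v\<close> divides the
      difference and \<open>p ^ Suc v\<close> does not, so the ratio is a nontrivial
      \<open>p\<close>-th root of unity.\<close>
    define v where "v = multiplicity (int p) (a - a')"
    have v: "v \<in> V" using diff[OF a True] by (simp add: v_def)
    have "\<not> is_unit (int p)" using p by (metis not_prime_unit prime_nat_int_transfer)
    then obtain u where u: "a - a' = int p ^ v * u" "\<not> int p dvd u"
      using multiplicity_decompose'[of "a - a'" "int p"] a(3) v_def by auto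
    have p0: "int p \<noteq> 0" using p by auto
    have c0: "c v \<noteq> 0" using cN[OF v] N(2) by auto
    have "\<not> int p ^ Suc v dvd a - a'" using u p0 by (simp add: mult.commute)
    then have "\<not> int N dvd (a - a') * c v"
      using c0 by (simp add: mult.commute[of _ "c v"] del: power_Suc flip: cN[OF v])
    moreover have "(a - a') * c v * int p = int N * u"
      using cN[OF v] unfolding u(1) by (simp add: mult_ac)
    then have "int N dvd (a - a') * c v * int p" by simp
    ultimately have "(\<Sum>k<p. (root_of_unity N powi ((a - a') * c v)) ^ k) = 0"
      using sum_powers_root_of_unity_eq_0 N(2) by blast
    then have "(\<Prod>v\<in>V. \<Sum>k<p. (root_of_unity N powi ((a - a') * c v)) ^ k) = 0"
      using v V' by (intro prod_zero) auto
    then show ?thesis by (simp add: factor)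
  qed
  show ?thesis
  proof (rule spectral_if_dual_orthogonal[OF N(2) A _ _ orth])
    show "finite ?I" using V' by (simp add: finite_PiE)
    show "card ?I = card A" using V' card by (simp add: card_cartesian_product card_PiE)
  qed
qed

section \<open>From tilings to complementing maps, and the theorem\<close>

lemma tiles_imp_complementing:
  assumes "N > 0" "tiles N A"
  obtains T where "complementing N (\<lambda>a. a) (\<lambda>t. t) A T"
proof -
  obtain T where A: "A \<subseteq> {0..<int N}" and T: "T \<subseteq> {0..<int N}"
    and uniq: "\<And>x. x \<in> {0..<int N} \<Longrightarrow> \<exists>!q. q \<in> A \<times> T \<and> x = (fst q + snd q) mod int N"
    using assms(2) unfolding tiles_def residue_ring_def
    by (auto simp: atLeastLessThanPlusOne_atLeastAtMost_int[symmetric])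
  let ?F = "\<lambda>(a, t). (a + t) mod int N"
  have mem: "?F q \<in> {0..<int N}" for q using assms(1) by (simp add: case_prod_beta)
  have inj: "inj_on ?F (A \<times> T)"
  proof (rule inj_onI)
    fix q q' assume *: "q \<in> A \<times> T" "q' \<in> A \<times> T" "?F q = ?F q'"
    have "\<exists>!r. r \<in> A \<times> T \<and> ?F q = ?F r"
      using uniq[OF mem[of q]] unfolding case_prod_beta .
    then show "q = q'" using * by blast
  qed
  have "?F ` (A \<times> T) = {0..<int N}"
  proof
    show "?F ` (A \<times> T) \<subseteq> {0..<int N}" using mem by blast
    show "{0..<int N} \<subseteq> ?F ` (A \<times> T)"
    proof
      fix x assume "x \<in> {0..<int N}"
      then obtain q where "q \<in> A \<times> T" "x = ?F q" using uniq by (metis case_prod_beta)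
      then show "x \<in> ?F ` (A \<times> T)" by blast
    qed
  qed
  then have "card (A \<times> T) = N" using card_image[OF inj] by simp
  moreover have "finite A" "finite T" using A T finite_subset by blast+
  ultimately have "complementing N (\<lambda>a. a) (\<lambda>t. t) A T"
    using inj assms(1) by (simp add: complementing_def card_cartesian_product)
  then show ?thesis by (rule that)
qed

theorem theorem1p5:
  fixes p :: "nat \<Rightarrow> nat" and n k N :: nat and A :: "int set"
  assumes "n \<ge> 1" and "k \<ge> 1"
    and "\<And>i. i \<in> {1..k} \<Longrightarrow> prime (p i)"
    and "inj_on p {1..k}"
    and "N = p 1 ^ n * (\<Prod>i\<in>{2..k}. p i)"
    and "A \<subseteq> carrier (ZMod N)"
    and "tiles N A"
  shows "spectral N A"
proof -
  \<comment> \<open>As \<open>k\<close> is positive, \<open>insert 1 {2..k}\<close> is the whole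
    index range, split as in the product for \<open>N\<close>.\<close>
  have prime: "prime (p i)" if "i \<in> insert 1 {2..k}" for i using assms(2,3) that by auto
  have cop: "coprime (p i) (p j)" if "i \<in> insert 1 {2..k}" "j \<in> insert 1 {2..k}" "i \<noteq> j" for i j
  proof -
    have "p i \<noteq> p j" using assms(2,4) that by (auto dest: inj_onD)
    then show ?thesis using prime that by (simp add: primes_coprime)
  qed
  have pos: "N > 0" using prime unfolding assms(5) by (auto intro!: prod_pos prime_gt_0_nat)
  obtain T where comp: "complementing N (\<lambda>a. a) (\<lambda>t. t) A T"
    using tiles_imp_complementing[OF pos assms(7)] .
  have card: "card A * card T = N" using comp by (simp add: complementing_def)
  define J where "J = {i \<in> {2..k}. p i dvd card A}"
  define U where "U = (\<Prod>i\<in>J. p i)"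
  define W where "W = (\<Prod>i\<in>{2..k} - J. p i)"
  have J: "J \<subseteq> {2..k}" by (auto simp: J_def)
  have N: "N = p 1 ^ n * U * W"
    unfolding assms(5) U_def W_def using prod.subset_diff[OF J, of p] by (simp add: mult_ac)
  have "coprime (p 1) U" "coprime (p 1) W"
    unfolding U_def W_def using J by (auto intro!: prod_coprime_right cop)
  moreover have "coprime U W"
    unfolding U_def W_def using J by (intro prod_coprime_left prod_coprime_right cop) auto
  moreover have "coprime W (card A)"
    unfolding W_def
    by (intro prod_coprime_left prime_imp_coprime prime) (auto simp: J_def)
  moreover have "coprime U (card T)"
    unfolding U_def
  proof (intro prod_coprime_left prime_imp_coprime notI)
    fix i assume i: "i \<in> J"
    then show "prime (p i)" using J prime by auto
    assume "p i dvd card T"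
    \<comment> \<open>A prime dividing both cardinalities would divide \<open>N\<close> twice, but
      each \<open>p i\<close> with \<open>i\<close> at least 2 occurs only once.\<close>
    then have "p i * p i dvd N" using i mult_dvd_mono[of "p i" "card A"] by (simp add: J_def flip: card)
    moreover have "N = p i * (p 1 ^ n * (\<Prod>j\<in>{2..k} - {i}. p j))"
      unfolding assms(5) using i J by (subst prod.remove[of _ i]) (auto simp: mult_ac)
    moreover have "p i \<noteq> 0" using \<open>prime (p i)\<close> by auto
    ultimately have "p i dvd p 1 ^ n * (\<Prod>j\<in>{2..k} - {i}. p j)" by simp
    moreover have "coprime (p i) (p 1 ^ n * (\<Prod>j\<in>{2..k} - {i}. p j))"
      using i J
      by (auto simp: coprime_mult_right_iff
          intro!: prod_coprime_right coprime_power_right_iff[THEN iffD2] cop)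
    ultimately show False
      using \<open>prime (p i)\<close> by (metis coprime_absorb_left not_prime_unit)
  qed
  ultimately obtain V where "V \<subseteq> {..<n}" "card A = p 1 ^ card V * U"
    "\<And>a a'. a \<in> A \<Longrightarrow> a' \<in> A \<Longrightarrow> a \<noteq> a' \<Longrightarrow> int U dvd a - a' \<Longrightarrow>
      multiplicity (int (p 1)) (a - a') \<in> V"
    using complementing_structure[OF comp N] prime by blast
  then show ?thesis
    using spectral_if_multiplicities[OF N pos _ assms(6)] prime by blast
qed

end
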